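(* Consider $\mathbb{R}^d$ with Lebesgue measure $\lambda^d$ and balls defined by an arbitrary norm, and let $M$ be the associated centered Hardy-Littlewood maximal operator. For every $\varepsilon>0$ there exists $d_0=d_0(\varepsilon)$, depending only on $\varepsilon$, such that for all $d\ge d_0$ (and every norm on $\mathbb{R}^d$), $$\|M\|_{L^1\to L^{1,\infty}}\le (2+3\varepsilon)\,d\log d .$$
   Context: Balls are $B(x,r):=\{y\in\mathbb{R}^d:\|x-y\|<r\}$ for the given norm. The centered maximal operator is $Mg(x):=\sup_{r>0}\frac{1}{\lambda^d(B(x,r))}\int_{B(x,r)}|g|\,d\lambda^d$. For a sublinear operator $S$, $\|S\|_{L^1\to L^{1,\infty}}$ denotes the lowest constant $c$ such that $\lambda^d(\{Sg>a\})\le c\|g\|_{L^1(\lambda^d)}/a$ for all $g\in L^1(\lambda^d)$ and all $a>0$. *)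

theory Defs
  imports "HOL-Analysis.Analysis"
begin

text \<open>
  Since the dimension \<open>d\<close> is quantified inside the statement, it cannot be the cardinality of an
  index type. A vector of \<open>\<real>\<^sup>d\<close> is a function on \<open>{..<d}\<close>, extended by \<open>undefined\<close> to \<open>nat\<close>; these
  functions are exactly the points of \<open>\<Pi>\<^sub>M i\<in>{..<d}. lborel\<close>. The completion turns Borel
  sets into Lebesgue sets, as in \<open>lebesgue = completion lborel\<close>.
\<close>

definition lebesgue_Rn :: "nat \<Rightarrow> (nat \<Rightarrow> real) measure" where
  "lebesgue_Rn d = completion (\<Pi>\<^sub>M i\<in>{..<d}. lborel)"

abbreviation Rn :: "nat \<Rightarrow> (nat \<Rightarrow> real) set" where
  "Rn d \<equiv> {..<d} \<rightarrow>\<^sub>E UNIV"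

lemma space_lebesgue_Rn: "space (lebesgue_Rn d) = Rn d"
  by (simp add: lebesgue_Rn_def space_PiM)

text \<open>
  The axioms are those of the class \<open>real_normed_vector\<close>, relativised to \<open>Rn d\<close>; they imply
  \<open>N x \<ge> 0\<close>.
\<close>

definition norm_on_Rn :: "nat \<Rightarrow> ((nat \<Rightarrow> real) \<Rightarrow> real) \<Rightarrow> bool" where
  "norm_on_Rn d N \<longleftrightarrow>
     (\<forall>x\<in>Rn d. N x = 0 \<longleftrightarrow> x = (\<lambda>i\<in>{..<d}. 0)) \<and>
     (\<forall>x\<in>Rn d. \<forall>y\<in>Rn d. N (\<lambda>i\<in>{..<d}. x i + y i) \<le> N x + N y) \<and>
     (\<forall>c. \<forall>x\<in>Rn d. N (\<lambda>i\<in>{..<d}. c * x i) = \<bar>c\<bar> * N x)"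

definition norm_ball ::
  "nat \<Rightarrow> ((nat \<Rightarrow> real) \<Rightarrow> real) \<Rightarrow> (nat \<Rightarrow> real) \<Rightarrow> real \<Rightarrow> (nat \<Rightarrow> real) set" where
  "norm_ball d N x r = {y \<in> Rn d. N (\<lambda>i\<in>{..<d}. x i - y i) < r}"

definition maximal_fun ::
  "nat \<Rightarrow> ((nat \<Rightarrow> real) \<Rightarrow> real) \<Rightarrow> ((nat \<Rightarrow> real) \<Rightarrow> real) \<Rightarrow> (nat \<Rightarrow> real) \<Rightarrow> ennreal" where
  "maximal_fun d N g x =
     (SUP r\<in>{0<..}. (\<integral>\<^sup>+y\<in>norm_ball d N x r. ennreal \<bar>g y\<bar> \<partial>lebesgue_Rn d)
                      / emeasure (lebesgue_Rn d) (norm_ball d N x r))"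

text \<open>
  The infimum is taken in \<open>ennreal\<close>, hence is \<open>\<infinity>\<close> if no finite constant is admissible.
  The definition is meant for operators whose level sets are measurable, as \<open>emeasure\<close> is \<open>0\<close> on
  non-measurable sets; the level sets of \<open>maximal_fun d N g\<close> are open if \<open>N\<close> is a norm.
\<close>

definition weak_L1_opnorm :: "'a measure \<Rightarrow> (('a \<Rightarrow> real) \<Rightarrow> 'a \<Rightarrow> ennreal) \<Rightarrow> ennreal" where
  "weak_L1_opnorm M S =
     Inf {c. \<forall>g. integrable M g \<longrightarrow> (\<forall>a>0.
               emeasure M {x \<in> space M. S g x > ennreal a}
                 \<le> c * ennreal (\<integral>x. \<bar>g x\<bar> \<partial>M) / ennreal a)}"

end

theory Submission
  imports Defs "HOL-Real_Asymp.Real_Asymp"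
begin

text \<open>
  The proof is a greedy covering argument in the style of Stein and Stromberg. Fix a level
  \<open>a > 0\<close> and \<open>0 < t \<le> 1\<close>. A point where the maximal function exceeds \<open>a\<close> is the centre \<open>x\<close> of a
  ball \<open>B(x, r)\<close> on which \<open>\<bar>g\<bar>\<close> has average above \<open>a\<close>. The level set is to be covered by the much
  smaller concentric balls \<open>B(x, t r)\<close>, and by a Lindelof and monotone limit argument it is enough
  to estimate the measure of finitely many of these.

  Go through the finitely many balls \<open>B\<^sub>i = B(x\<^sub>i, r\<^sub>i)\<close> by decreasing radius. A selected ball
  receives the set \<open>D\<^sub>i\<close> of those points of \<open>B(x\<^sub>i, t r\<^sub>i)\<close> that are not in the small ball of a
  ball selected earlier; the sets \<open>D\<^sub>i\<close> are disjoint. The ball \<open>B\<^sub>i\<close> is selected exactly if its centre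
  is not yet crowded, that is, if \<open>\<Sum> (\<bar>D\<^sub>j\<bar> / \<bar>B\<^sub>j\<bar>) 1(x\<^sub>i \<in> B(x\<^sub>j, (1+t) r\<^sub>j)) \<le> 1\<close>, where the sum is over the
  balls selected before. Two estimates result.

  \<^item> The small balls of discarded indices lie in the set where the analogous sum with dilation
    \<open>1+2t\<close> exceeds \<open>1\<close>. By Markov's inequality (\<open>crowded_set_measure\<close>) it has measure at most
    \<open>(1+2t)\<^sup>d \<Sum> \<bar>D\<^sub>j\<bar>\<close>, so all small balls together have measure at most
    \<open>(1 + (1+2t)\<^sup>d) \<Sum> \<bar>D\<^sub>j\<bar>\<close>.

  \<^item> The weighted overlap \<open>\<Sum> (\<bar>D\<^sub>j\<bar> / \<bar>B\<^sub>j\<bar>) 1(y \<in> B\<^sub>j)\<close> is at most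
    \<open>1 + (1+t)\<^sup>d (1 + d log (1/t))\<close> at every point \<open>y\<close> (\<open>bounded_overlap\<close>). To see this, let \<open>r\<close> be the
    smallest radius of a selected ball containing \<open>y\<close>. The balls of radius above \<open>r/t\<close>, after
    dilation by \<open>1+t\<close>, contain the centre of this smallest ball, so the selection rule bounds
    their contribution by \<open>1\<close>. The sets \<open>D\<^sub>j\<close> of the radii between \<open>r\<close> and \<open>r/t\<close> are disjoint, and
    those with \<open>r\<^sub>j \<le> s\<close> lie in \<open>B(y, (1+t) s)\<close>; summation by parts then gives the logarithm
    \<open>log ((1/t)\<^sup>d)\<close> (\<open>sum_weight_quotient_le_log\<close>).

  Integrating \<open>\<bar>g\<bar>\<close> against the weighted overlap shows that \<open>a \<Sum> \<bar>D\<^sub>j\<bar>\<close> is at most the overlap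
  bound times the norm of \<open>g\<close>. Hence the weak type constant is at most
  \<open>(1 + (1+2t)\<^sup>d) (1 + (1+t)\<^sup>d (1 + d log (1/t)))\<close>. For \<open>t = 1 / (d log d)\<close> both powers tend to \<open>1\<close>,
  whereas \<open>log (1/t)\<close> is asymptotic to \<open>log d\<close>, so this is asymptotic to \<open>2 d log d\<close>. The norm
  enters only through the triangle inequality and the volume \<open>V r\<^sup>d\<close> of its balls; therefore the
  bound depends on \<open>d\<close> alone.
\<close>

section \<open>The constant and its asymptotics\<close>

definition weak_type_bound :: "nat \<Rightarrow> real \<Rightarrow> real" where
  "weak_type_bound d t = (1 + (1 + 2 * t) ^ d) * (1 + (1 + t) ^ d * (1 + d * ln (1 / t)))"

text \<open>
  The value of \<open>t\<close> has to satisfy \<open>t = o(1/d)\<close>, so that the powers do not contribute, but also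
  \<open>log (1/t) \<sim> log d\<close>; a choice such as \<open>1 / d\<^sup>2\<close> would double the constant.
\<close>

lemma weak_type_bound_asymp:
  "(\<lambda>d. weak_type_bound d (1 / (real d * ln (real d))) / (real d * ln (real d))) \<longlonglongrightarrow> 2"
  unfolding weak_type_bound_def by real_asymp

section \<open>Summation by parts\<close>

text \<open>
  The bound is the discrete form of \<open>\<integral> dm(s) / s \<le> K (1 + log (b/a))\<close> for a mass distribution with
  \<open>m(s) \<le> K s\<close> on \<open>[a, b]\<close>. Keeping the total mass divided by \<open>b\<close> on the right-hand side makes
  the induction work: the element with the largest \<open>u\<close> is added at \<open>b = u\<close>, where it contributes
  the same to both sides, and then \<open>b\<close> is raised, which costs at most
  \<open>K (1 - u/b) \<le> K log (b/u)\<close>.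
\<close>

lemma sum_weight_quotient_le_log:
  fixes u w :: "'i \<Rightarrow> real"
  assumes "finite J" "a > 0" "a \<le> b" "K \<ge> 0"
    and "\<And>j. j \<in> J \<Longrightarrow> a \<le> u j \<and> u j \<le> b"
    and "\<And>j. j \<in> J \<Longrightarrow> 0 \<le> w j"
    and "\<And>j. j \<in> J \<Longrightarrow> (\<Sum>k\<in>{k\<in>J. u k \<le> u j}. w k) \<le> K * u j"
  shows "(\<Sum>j\<in>J. w j / u j) \<le> (\<Sum>j\<in>J. w j) / b + K * ln (b / a)"
  using assms(1,3-)
proof (induction J arbitrary: b rule: finite_ranking_induct[where f = u])
  case empty
  then show ?case using \<open>a > 0\<close> by simp
next
  case (insert m J)
  show ?case
  proof (cases "m \<in> J")
    case True
    then have eq: "insert m J = J" by auto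
    show ?thesis using insert.IH[of b] insert.prems unfolding eq by blast
  next
    case False
    define W where "W = (\<Sum>j\<in>J. w j)"
    have pos: "0 < u m" "u m \<le> b" "a \<le> u m" using insert.prems(3)[of m] \<open>a > 0\<close> by auto
    have "(\<Sum>j\<in>J. w j / u j) \<le> W / u m + K * ln (u m / a)"
      unfolding W_def
    proof (rule insert.IH)
      fix j assume j: "j \<in> J"
      have "(\<Sum>k\<in>{k\<in>J. u k \<le> u j}. w k) \<le> (\<Sum>k\<in>{k\<in>insert m J. u k \<le> u j}. w k)"
        using insert.hyps(1) insert.prems(4) by (intro sum_mono2) auto
      also have "\<dots> \<le> K * u j" using insert.prems(5) j by blast
      finally show "(\<Sum>k\<in>{k\<in>J. u k \<le> u j}. w k) \<le> K * u j" .
    qed (use insert pos in auto)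
    moreover have total: "w m + W \<le> K * u m"
    proof -
      have "{k\<in>insert m J. u k \<le> u m} = insert m J" using insert.hyps by auto
      then show ?thesis using insert.prems(5)[of m] insert.hyps(1) False by (simp add: W_def)
    qed
    \<comment> \<open>the loss when the upper end is raised from \<open>u m\<close> to \<open>b\<close>\<close>
    moreover have "(w m + W) * (1 / u m - 1 / b) \<le> K * ln (b / u m)"
    proof -
      have "(w m + W) * (1 / u m - 1 / b) \<le> K * u m * (1 / u m - 1 / b)"
        using total pos by (intro mult_right_mono) (auto simp: field_simps)
      also have "\<dots> = K * (1 - u m / b)" using pos by (simp add: field_simps)
      also have "\<dots> \<le> K * ln (b / u m)"
        using ln_le_minus_one[of "u m / b"] pos \<open>K \<ge> 0\<close>
        by (intro mult_left_mono) (auto simp: ln_div)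
      finally show ?thesis .
    qed
    moreover have "ln (b / a) = ln (b / u m) + ln (u m / a)"
      using pos \<open>a > 0\<close> by (simp add: ln_div)
    ultimately show ?thesis
      using insert.hyps(1) False
      by (simp add: W_def algebra_simps add_divide_distrib)
  qed
qed

section \<open>Greedy selection\<close>

primrec greedy :: "(nat set \<Rightarrow> nat \<Rightarrow> bool) \<Rightarrow> nat \<Rightarrow> nat set" where
  "greedy P 0 = {}"
| "greedy P (Suc n) = greedy P n \<union> (if P (greedy P n) n then {n} else {})"

text \<open>
  The process is infinite and takes no account of how many balls there are; truncating its result
  at \<open>n\<close> gives the selection from the first \<open>n\<close> balls.
\<close>

lemma greedy_selection: "\<exists>S. \<forall>i. i \<in> S \<longleftrightarrow> P (S \<inter> {..<i}) i" for P :: "nat set \<Rightarrow> nat \<Rightarrow> bool"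
proof -
  let ?S = "\<Union>n. greedy P n"
  have sub: "greedy P n \<subseteq> {..<n}" for n by (induction n) (auto split: if_splits)
  have mem: "i \<in> greedy P n \<longleftrightarrow> i < n \<and> P (greedy P i) i" for i n
    using sub by (induction n) (auto simp: less_Suc_eq)
  have S: "i \<in> ?S \<longleftrightarrow> P (greedy P i) i" for i
    by (auto simp: mem)
  have "?S \<inter> {..<i} = greedy P i" for i
    by (rule set_eqI) (metis IntE IntI S lessThan_iff mem)
  then show ?thesis using S by metis
qed

section \<open>The covering argument\<close>

text \<open>
  The covering argument takes place in any measure space in which the balls of radius \<open>r\<close> of a
  symmetric function with the triangle inequality all have the same measure \<open>V r\<^sup>d\<close>. For a norm this
  is the translation invariance and homogeneity of Lebesgue measure.
\<close>

locale homogeneous_balls =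
  fixes M :: "'a measure" and \<rho> :: "'a \<Rightarrow> 'a \<Rightarrow> real" and d :: nat and V :: real
    and B :: "'a \<Rightarrow> real \<Rightarrow> 'a set"
  assumes B_def: "B x r = {y \<in> space M. \<rho> x y < r}"
    and sym: "\<lbrakk>x \<in> space M; y \<in> space M\<rbrakk> \<Longrightarrow> \<rho> x y = \<rho> y x"
    and triangle: "\<lbrakk>x \<in> space M; y \<in> space M; z \<in> space M\<rbrakk> \<Longrightarrow> \<rho> x z \<le> \<rho> x y + \<rho> y z"
    and ball_sets [measurable]: "x \<in> space M \<Longrightarrow> B x r \<in> sets M"
    and emeasure_ball: "\<lbrakk>x \<in> space M; r > 0\<rbrakk> \<Longrightarrow> emeasure M (B x r) = ennreal (V * r ^ d)"
    and V_pos: "V > 0" and d_pos: "d > 0"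
begin

lemma measure_ball: "\<lbrakk>x \<in> space M; r > 0\<rbrakk> \<Longrightarrow> measure M (B x r) = V * r ^ d"
  using V_pos by (simp add: measure_def emeasure_ball)

lemma ball_fmeasurable: "\<lbrakk>x \<in> space M; r > 0\<rbrakk> \<Longrightarrow> B x r \<in> fmeasurable M"
  by (simp add: fmeasurable_def ball_sets emeasure_ball)

lemma ball_subset:
  assumes "x \<in> space M" "y \<in> space M" "\<rho> x y < s"
  shows "B x r \<subseteq> B y (r + s)"
  using assms sym[of x y] triangle[of y x] by (fastforce simp: B_def)

text \<open>
  Scales are split according to whether they exceed \<open>1/t\<close> times the
  smallest radius \<open>r l\<close> of a ball containing \<open>y\<close>: above, the geometry at \<open>y\<close> and at the centre \<open>x l\<close>
  is the same up to a factor \<open>1 + t\<close>, and below there is only room for a logarithm.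
\<close>

lemma bounded_overlap:
  fixes x :: "nat \<Rightarrow> 'a" and r :: "nat \<Rightarrow> real" and D :: "nat \<Rightarrow> 'a set"
  assumes fin: "finite S" and t: "0 < t" "t \<le> 1"
    and x: "\<And>j. j \<in> S \<Longrightarrow> x j \<in> space M" and r: "\<And>j. j \<in> S \<Longrightarrow> r j > 0"
    and decr: "\<And>i j. \<lbrakk>i \<in> S; j \<in> S; i \<le> j\<rbrakk> \<Longrightarrow> r j \<le> r i"
    and D: "\<And>j. j \<in> S \<Longrightarrow> D j \<in> sets M" "\<And>j. j \<in> S \<Longrightarrow> D j \<subseteq> B (x j) (t * r j)"
    and disj: "disjoint_family_on D S"
    and sel: "\<And>i. i \<in> S \<Longrightarrow>
      (\<Sum>j\<in>S \<inter> {..<i}. measure M (D j) / (V * r j ^ d) * indicator (B (x j) ((1 + t) * r j)) (x i)) \<le> 1"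
    and y: "y \<in> space M"
  shows "(\<Sum>j\<in>S. measure M (D j) / (V * r j ^ d) * indicator (B (x j) (r j)) y)
           \<le> 1 + (1 + t) ^ d * (1 + d * ln (1 / t))"
proof -
  define w where "w j = measure M (D j) / (V * r j ^ d)" for j
  define J where "J = {j \<in> S. y \<in> B (x j) (r j)}"
  have J: "finite J" "J \<subseteq> S" using fin by (auto simp: J_def)
  have w0: "w j \<ge> 0" if "j \<in> S" for j using r[OF that] V_pos by (simp add: w_def)
  have sum_J: "(\<Sum>j\<in>S. w j * indicator (B (x j) (r j)) y) = (\<Sum>j\<in>J. w j)"
    using fin unfolding J_def by (intro sum.mono_neutral_cong_right) auto
  have bound0: "0 \<le> (1 + t) ^ d * (1 + d * ln (1 / t))"
    using t by (intro mult_nonneg_nonneg add_nonneg_nonneg) (auto simp: ln_div)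
  show ?thesis
  proof (cases "J = {}")
    case True
    then show ?thesis using sum_J bound0 by (simp add: w_def)
  next
    case False
    \<comment> \<open>radii decrease along the indices, so the last ball containing \<open>y\<close> is a smallest one\<close>
    define l where "l = Max J"
    have l: "l \<in> J" "\<And>j. j \<in> J \<Longrightarrow> j \<le> l"
      using False J by (auto simp: l_def)
    then have lS: "l \<in> S" "r l > 0" using J r by auto
    \<comment> \<open>for \<open>j\<close> in \<open>far\<close>, the distance from \<open>x j\<close> to \<open>x l\<close> is below \<open>r j + r l \<le> (1 + t) * r j\<close>\<close>
    define far where "far = {j \<in> J. r l < t * r j}"
    define near where "near = {j \<in> J. t * r j \<le> r l}"
    have "(\<Sum>j\<in>far. w j) \<le> (\<Sum>j\<in>S \<inter> {..<l}. w j * indicator (B (x j) ((1 + t) * r j)) (x l))"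
    proof -
      have "far \<subseteq> S \<inter> {..<l}"
      proof
        fix j assume j: "j \<in> far"
        then have "j \<in> S" "j \<le> l" "r l < t * r j" using l J by (auto simp: far_def)
        moreover have "t * r j \<le> r j" using t r[OF \<open>j \<in> S\<close>] by simp
        ultimately show "j \<in> S \<inter> {..<l}" by (cases "j = l") auto
      qed
      moreover have "x l \<in> B (x j) ((1 + t) * r j)" if "j \<in> far" for j
      proof -
        have "\<rho> (x j) (x l) \<le> \<rho> (x j) y + \<rho> y (x l)"
          using that J lS x y by (intro triangle) (auto simp: far_def)
        also have "\<rho> y (x l) = \<rho> (x l) y" using lS x y by (intro sym) auto
        finally show ?thesis using that l(1) lS x by (auto simp: far_def J_def B_def algebra_simps)
      qed
      ultimately have sub: "far \<subseteq> S \<inter> {..<l}"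
        and "(\<Sum>j\<in>far. w j) = (\<Sum>j\<in>far. w j * indicator (B (x j) ((1 + t) * r j)) (x l))"
        by simp_all
      note this(2)
      also have "(\<Sum>j\<in>far. w j * indicator (B (x j) ((1 + t) * r j)) (x l))
          \<le> (\<Sum>j\<in>S \<inter> {..<l}. w j * indicator (B (x j) ((1 + t) * r j)) (x l))"
        by (rule sum_mono2[OF _ sub]) (use fin w0 in auto)
      finally show ?thesis .
    qed
    also have "\<dots> \<le> 1" using sel[OF lS(1)] by (simp add: w_def)
    finally have far: "(\<Sum>j\<in>far. w j) \<le> 1" .

    define K where "K = V * (1 + t) ^ d"
    define b where "b = (r l / t) ^ d"
    have K0: "K \<ge> 0" using V_pos t by (simp add: K_def)
    have b0: "b > 0" using lS t by (simp add: b_def)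
    have nearS: "finite near" "near \<subseteq> S" using J by (auto simp: near_def)
    \<comment> \<open>the hypothesis of the summation by parts: disjoint sets inside one ball around \<open>y\<close>\<close>
    have packing: "(\<Sum>k\<in>A. measure M (D k)) \<le> K * s ^ d"
      if A: "A \<subseteq> near" "\<And>k. k \<in> A \<Longrightarrow> r k \<le> s" and s: "s > 0" for A s
    proof -
      have A': "finite A" "A \<subseteq> S" using A nearS finite_subset by auto
      have "(\<Sum>k\<in>A. measure M (D k)) = measure M (\<Union>k\<in>A. D k)"
      proof (rule measure_finite_Union[symmetric])
        show "disjoint_family_on D A" using disj A' by (meson disjoint_family_on_mono)
        fix k assume "k \<in> A"
        then have k: "k \<in> S" using A' by auto
        have "emeasure M (D k) \<le> emeasure M (B (x k) (t * r k))"
          using D k x by (intro emeasure_mono) auto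
        then show "emeasure M (D k) \<noteq> \<infinity>" using emeasure_ball[of "x k" "t * r k"] x r k t
          by (auto simp: top_unique)
      qed (use A' D in auto)
      also have "\<dots> \<le> measure M (B y ((1 + t) * s))"
      proof (rule measure_mono_fmeasurable)
        show "(\<Union>k\<in>A. D k) \<subseteq> B y ((1 + t) * s)"
        proof (rule UN_least)
          fix k assume k: "k \<in> A"
          have "D k \<subseteq> B (x k) (t * r k)" using D k A' by auto
          also have "\<dots> \<subseteq> B y (t * r k + r k)"
            using k A A' x y by (intro ball_subset) (auto simp: near_def J_def B_def)
          also have "\<dots> \<subseteq> B y ((1 + t) * s)"
          proof -
            have "t * r k + r k \<le> (1 + t) * s"
              using A(2)[OF k] t mult_left_mono[of "r k" s "1 + t"] by (simp add: algebra_simps)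
            then show ?thesis by (auto simp: B_def)
          qed
          finally show "D k \<subseteq> B y ((1 + t) * s)" .
        qed
      qed (use A' D y s t ball_fmeasurable in auto)
      also have "\<dots> = K * s ^ d" using y s t by (simp add: measure_ball K_def power_mult_distrib)
      finally show ?thesis .
    qed
    have "(\<Sum>j\<in>near. measure M (D j) / r j ^ d)
            \<le> (\<Sum>j\<in>near. measure M (D j)) / b + K * ln (b / r l ^ d)"
    proof (rule sum_weight_quotient_le_log[where a = "r l ^ d" and u = "\<lambda>j. r j ^ d"])
      show "r l ^ d \<le> b" unfolding b_def using lS t by (intro power_mono) (auto simp: field_simps)
      fix j assume j: "j \<in> near"
      have "r l \<le> r j" using j l lS J decr by (auto simp: near_def)
      moreover have "r j \<le> r l / t" using j t by (simp add: near_def field_simps)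
      ultimately show "r l ^ d \<le> r j ^ d \<and> r j ^ d \<le> b"
        unfolding b_def using lS by (auto intro!: power_mono)
      show "0 \<le> measure M (D j)" by simp
      have rj: "r j > 0" using j nearS r by auto
      show "(\<Sum>k\<in>{k\<in>near. r k ^ d \<le> r j ^ d}. measure M (D k)) \<le> K * r j ^ d"
      proof (rule packing)
        fix k assume "k \<in> {k\<in>near. r k ^ d \<le> r j ^ d}"
        then show "r k \<le> r j" using d_pos rj power_le_imp_le_base[of "r k" "d - 1" "r j"] by simp
      qed (use rj in auto)
    qed (use nearS lS K0 in auto)
    also have "(\<Sum>j\<in>near. measure M (D j)) / b \<le> K"
      using packing[of near "r l / t"] lS t b0
      by (simp add: near_def field_simps b_def)
    also have "b / r l ^ d = (1 / t) ^ d"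
      using lS by (simp add: b_def power_divide)
    also have "ln ((1 / t) ^ d) = d * ln (1 / t)" using t by (simp add: ln_realpow)
    finally have *: "(\<Sum>j\<in>near. measure M (D j) / r j ^ d) \<le> K * (1 + d * ln (1 / t))"
      by (simp add: algebra_simps)
    have "(\<Sum>j\<in>near. w j) = (\<Sum>j\<in>near. measure M (D j) / r j ^ d) / V"
      by (simp add: w_def sum_divide_distrib mult.commute)
    also have "\<dots> \<le> K * (1 + d * ln (1 / t)) / V" using * V_pos by (simp add: divide_right_mono)
    also have "\<dots> = (1 + t) ^ d * (1 + d * ln (1 / t))" using V_pos by (simp add: K_def)
    finally have near: "(\<Sum>j\<in>near. w j) \<le> (1 + t) ^ d * (1 + d * ln (1 / t))" .
    have "J = far \<union> near" "far \<inter> near = {}" by (auto simp: far_def near_def)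
    then have "(\<Sum>j\<in>J. w j) = (\<Sum>j\<in>far. w j) + (\<Sum>j\<in>near. w j)"
      using J by (metis sum.union_disjoint finite_Un)
    then show ?thesis using far near sum_J by (simp add: w_def)
  qed
qed

text \<open>
  Each summand is normalised so that its integral is \<open>m j\<close>, up to the dilation factor \<open>s ^ d\<close>; the
  estimate is Markov's inequality at height \<open>1\<close>.
\<close>

lemma crowded_set_measure:
  fixes x :: "nat \<Rightarrow> 'a" and r m :: "nat \<Rightarrow> real"
  assumes fin: "finite S" and s: "s > 0"
    and x: "\<And>j. j \<in> S \<Longrightarrow> x j \<in> space M" and r: "\<And>j. j \<in> S \<Longrightarrow> r j > 0"
    and m: "\<And>j. j \<in> S \<Longrightarrow> m j \<ge> 0"
  shows "emeasure M {z \<in> space M. 1 < (\<Sum>j\<in>S. m j / (V * r j ^ d) * indicator (B (x j) (s * r j)) z)}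
           \<le> ennreal (s ^ d * (\<Sum>j\<in>S. m j))"
proof -
  define c where "c j = m j / (V * r j ^ d)" for j
  have c: "c j \<ge> 0" if "j \<in> S" for j using m r V_pos that by (simp add: c_def less_imp_le)
  let ?f = "\<lambda>z. \<Sum>j\<in>S. ennreal (c j) * indicator (B (x j) (s * r j)) z"
  have f: "?f z = ennreal (\<Sum>j\<in>S. c j * indicator (B (x j) (s * r j)) z)" for z
    using c by (subst sum_ennreal[symmetric]) (auto simp: ennreal_mult' ennreal_indicator)
  have "emeasure M {z \<in> space M. 1 < (\<Sum>j\<in>S. c j * indicator (B (x j) (s * r j)) z)}
      \<le> emeasure M {z \<in> space M. 1 \<le> 1 * ?f z}"
  proof (rule emeasure_mono)
    show "{z \<in> space M. 1 < (\<Sum>j\<in>S. c j * indicator (B (x j) (s * r j)) z)}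
            \<subseteq> {z \<in> space M. 1 \<le> 1 * ?f z}"
      unfolding f by auto
    show "{z \<in> space M. 1 \<le> 1 * ?f z} \<in> sets M" using x by measurable
  qed
  also have "\<dots> \<le> 1 * (\<integral>\<^sup>+z\<in>space M. ?f z \<partial>M)"
    using x by (intro nn_integral_Markov_inequality) auto
  also have "(\<integral>\<^sup>+z\<in>space M. ?f z \<partial>M) = (\<Sum>j\<in>S. ennreal (c j) * emeasure M (B (x j) (s * r j)))"
  proof -
    have "(\<integral>\<^sup>+z\<in>space M. ?f z \<partial>M) = (\<integral>\<^sup>+z. ?f z \<partial>M)" by (intro nn_integral_cong) simp
    then show ?thesis using x by (simp add: nn_integral_sum nn_integral_cmult_indicator)
  qed
  also have "\<dots> = (\<Sum>j\<in>S. ennreal (s ^ d * m j))"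
  proof (rule sum.cong[OF refl])
    fix j assume j: "j \<in> S"
    have "c j * (V * (s * r j) ^ d) = s ^ d * m j"
      using r[OF j] V_pos by (simp add: c_def power_mult_distrib)
    then show "ennreal (c j) * emeasure M (B (x j) (s * r j)) = ennreal (s ^ d * m j)"
      using x[OF j] r[OF j] s c[OF j] by (simp add: emeasure_ball ennreal_mult'[symmetric])
  qed
  also have "\<dots> = ennreal (s ^ d * (\<Sum>j\<in>S. m j))"
    using m s by (subst sum_ennreal) (auto simp: sum_distrib_left)
  finally show ?thesis by (simp add: c_def)
qed

text \<open>
  The sets \<open>D j\<close> depend on the selection among the indices below \<open>j\<close> only, so the rule that decides
  about \<open>i\<close> can be evaluated before \<open>i\<close> is reached, and the abstract greedy process applies.
\<close>

lemma selection:
  fixes x :: "nat \<Rightarrow> 'a" and r :: "nat \<Rightarrow> real"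
  obtains S D where
    "\<And>j. D j = B (x j) (t * r j) - (\<Union>k\<in>S \<inter> {..<j}. B (x k) (t * r k))"
    "\<And>i. i \<in> S \<longleftrightarrow> (\<Sum>j\<in>S \<inter> {..<i}.
       measure M (D j) / (V * r j ^ d) * indicator (B (x j) ((1 + t) * r j)) (x i)) \<le> 1"
proof -
  define D where "D S j = B (x j) (t * r j) - (\<Union>k\<in>S \<inter> {..<j}. B (x k) (t * r k))" for S j
  define P where "P S i \<longleftrightarrow> (\<Sum>j\<in>S.
       measure M (D S j) / (V * r j ^ d) * indicator (B (x j) ((1 + t) * r j)) (x i)) \<le> 1" for S i
  obtain S where S: "\<And>i. i \<in> S \<longleftrightarrow> P (S \<inter> {..<i}) i"
    using greedy_selection[of P] by blast
  have "D (S \<inter> {..<i}) j = D S j" if "j < i" for i j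
  proof -
    have "S \<inter> {..<i} \<inter> {..<j} = S \<inter> {..<j}" using that by auto
    then show ?thesis by (simp add: D_def)
  qed
  then have P: "P (S \<inter> {..<i}) i \<longleftrightarrow> (\<Sum>j\<in>S \<inter> {..<i}.
       measure M (D S j) / (V * r j ^ d) * indicator (B (x j) ((1 + t) * r j)) (x i)) \<le> 1" for i
    unfolding P_def by (intro arg_cong2[where f = "(\<le>)"] sum.cong) auto
  show ?thesis by (rule that[of "D S" S]) (rule D_def, rule trans[OF S P])
qed

text \<open>
  The heart of the argument. The sets \<open>D j\<close> exhaust the small balls that were selected, and the
  crowded set contains those that were not, so that \<open>\<Sum> \<bar>D j\<bar>\<close> controls the union up to the factor
  \<open>1 + (1 + 2 * t) ^ d\<close>. Conversely \<open>a \<bar>D j\<bar>\<close> is at most \<open>\<bar>D j\<bar> / \<bar>B j\<bar>\<close> times the integral of \<open>f\<close>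
  over the ball \<open>B j\<close>, and summing over \<open>j\<close> brings in the bounded overlap.
\<close>

lemma sorted_family_bound:
  fixes x :: "nat \<Rightarrow> 'a" and r :: "nat \<Rightarrow> real" and f :: "'a \<Rightarrow> ennreal"
  assumes t: "0 < t" "t \<le> 1"
    and x: "\<And>i. i < n \<Longrightarrow> x i \<in> space M" and r: "\<And>i. i < n \<Longrightarrow> r i > 0"
    and decr: "\<And>i j. \<lbrakk>i \<le> j; j < n\<rbrakk> \<Longrightarrow> r j \<le> r i"
    and f [measurable]: "f \<in> borel_measurable M"
    and a: "\<And>i. i < n \<Longrightarrow> a * emeasure M (B (x i) (r i)) \<le> (\<integral>\<^sup>+z\<in>B (x i) (r i). f z \<partial>M)"
  shows "a * emeasure M (\<Union>i<n. B (x i) (t * r i)) \<le> ennreal (weak_type_bound d t) * (\<integral>\<^sup>+z. f z \<partial>M)"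
proof -
  obtain S D where D: "\<And>j. D j = B (x j) (t * r j) - (\<Union>k\<in>S \<inter> {..<j}. B (x k) (t * r k))"
    and S: "\<And>i. i \<in> S \<longleftrightarrow> (\<Sum>j\<in>S \<inter> {..<i}.
       measure M (D j) / (V * r j ^ d) * indicator (B (x j) ((1 + t) * r j)) (x i)) \<le> 1"
    by (rule selection[of x t r]) (rule that; assumption)
  define T where "T = S \<inter> {..<n}"
  have T: "finite T" "\<And>j. j \<in> T \<Longrightarrow> j < n" "\<And>j. j \<in> T \<Longrightarrow> j \<in> S" by (auto simp: T_def)
  have TS: "T \<inter> {..<i} = S \<inter> {..<i}" if "i \<le> n" for i using that by (auto simp: T_def)
  have Dsub: "D j \<subseteq> B (x j) (t * r j)" for j by (auto simp: D)
  have Dsets: "D j \<in> sets M" if "j < n" for j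
    unfolding D using that x by (intro sets.Diff sets.finite_UN) auto
  have Dfin: "emeasure M (D j) = ennreal (measure M (D j))" if "j < n" for j
  proof -
    have "emeasure M (D j) \<le> emeasure M (B (x j) (t * r j))"
      using Dsub x that by (intro emeasure_mono) auto
    then show ?thesis using emeasure_ball[of "x j" "t * r j"] x r t that
      by (intro emeasure_eq_ennreal_measure) (auto simp: top_unique)
  qed
  have disj: "disjoint_family_on D S"
    unfolding disjoint_family_on_def
  proof (intro ballI impI)
    fix i j assume "i \<in> S" "j \<in> S" "i \<noteq> j"
    then show "D i \<inter> D j = {}" by (cases i j rule: linorder_cases) (auto simp: D)
  qed
  then have disjT: "disjoint_family_on D T" by (auto simp: disjoint_family_on_def T_def)
  define \<phi> where "\<phi> s z = (\<Sum>j\<in>T. measure M (D j) / (V * r j ^ d) * indicator (B (x j) (s * r j)) z)" for s z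
  define m where "m = (\<Sum>j\<in>T. measure M (D j))"
  have w0: "0 \<le> measure M (D j) / (V * r j ^ d)" if "j \<in> T" for j
    using T r V_pos that by (simp add: less_imp_le)
  define L where "L = 1 + (1 + t) ^ d * (1 + d * ln (1 / t))"

  have "(\<Union>i<n. B (x i) (t * r i)) \<subseteq> (\<Union>j\<in>T. D j) \<union> {z \<in> space M. 1 < \<phi> (1 + 2 * t) z}"
  proof (rule UN_least)
    fix i assume i: "i \<in> {..<n}"
    show "B (x i) (t * r i) \<subseteq> (\<Union>j\<in>T. D j) \<union> {z \<in> space M. 1 < \<phi> (1 + 2 * t) z}"
    proof (cases "i \<in> S")
      case True
      show ?thesis
      proof
        fix z assume z: "z \<in> B (x i) (t * r i)"
        \<comment> \<open>\<open>z\<close> may lie in an earlier small ball as well; the earliest one owns it\<close>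
        define k where "k = (LEAST k. k \<in> S \<and> z \<in> B (x k) (t * r k))"
        have k: "k \<in> S \<and> z \<in> B (x k) (t * r k)"
          unfolding k_def by (rule LeastI[where P = "\<lambda>k. k \<in> S \<and> z \<in> B (x k) (t * r k)" and k = i]) (use True z in blast)
        have min: "k \<le> k'" if "k' \<in> S" "z \<in> B (x k') (t * r k')" for k'
          unfolding k_def using that by (blast intro: Least_le)
        have "z \<in> D k" using k min by (force simp: D)
        moreover have "k \<in> T" using k min[OF True z] i by (auto simp: T_def)
        ultimately show "z \<in> (\<Union>j\<in>T. D j) \<union> {z \<in> space M. 1 < \<phi> (1 + 2 * t) z}" by auto
      qed
    next
      case False
      show ?thesis
      proof
        fix z assume z: "z \<in> B (x i) (t * r i)"
        then have zM: "z \<in> space M" by (simp add: B_def)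
        have "1 < (\<Sum>j\<in>S \<inter> {..<i}. measure M (D j) / (V * r j ^ d) *
                  indicator (B (x j) ((1 + t) * r j)) (x i))"
          using False S[of i] by simp
        also have "\<dots> \<le> (\<Sum>j\<in>S \<inter> {..<i}. measure M (D j) / (V * r j ^ d) *
                  indicator (B (x j) ((1 + 2 * t) * r j)) z)"
        proof (rule sum_mono)
          fix j assume j: "j \<in> S \<inter> {..<i}"
          then have jT: "j \<in> T" using i by (auto simp: T_def)
          \<comment> \<open>\<open>z\<close> is within \<open>t * r i \<le> t * r j\<close> of the crowded centre \<open>x i\<close>\<close>
          have "z \<in> B (x j) ((1 + 2 * t) * r j)" if "x i \<in> B (x j) ((1 + t) * r j)"
          proof -
            have "\<rho> (x j) z \<le> \<rho> (x j) (x i) + \<rho> (x i) z"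
              using j i x zM by (intro triangle) auto
            also have "\<dots> < (1 + t) * r j + t * r i"
              using that z by (auto simp: B_def)
            also have "\<dots> \<le> (1 + 2 * t) * r j"
              using decr[of j i] j i t by (simp add: algebra_simps)
            finally show ?thesis using zM by (simp add: B_def)
          qed
          then have "indicator (B (x j) ((1 + t) * r j)) (x i)
              \<le> (indicator (B (x j) ((1 + 2 * t) * r j)) z :: real)"
            by (auto split: split_indicator)
          then show "measure M (D j) / (V * r j ^ d) * indicator (B (x j) ((1 + t) * r j)) (x i)
              \<le> measure M (D j) / (V * r j ^ d) * indicator (B (x j) ((1 + 2 * t) * r j)) z"
            using w0[OF jT] by (rule mult_left_mono)
        qed
        also have "\<dots> \<le> \<phi> (1 + 2 * t) z"
          unfolding \<phi>_def
        proof (rule sum_mono2)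
          fix j assume "j \<in> T - S \<inter> {..<i}"
          then show "0 \<le> measure M (D j) / (V * r j ^ d) * indicator (B (x j) ((1 + 2 * t) * r j)) z"
            by (intro mult_nonneg_nonneg w0) auto
        qed (use T i in \<open>auto simp: T_def\<close>)
        finally show "z \<in> (\<Union>j\<in>T. D j) \<union> {z \<in> space M. 1 < \<phi> (1 + 2 * t) z}"
          using zM by simp
      qed
    qed
  qed
  then have "emeasure M (\<Union>i<n. B (x i) (t * r i))
      \<le> emeasure M ((\<Union>j\<in>T. D j) \<union> {z \<in> space M. 1 < \<phi> (1 + 2 * t) z})"
    by (rule emeasure_mono) (use T Dsets x in \<open>auto simp: \<phi>_def intro!: sets.Un sets.finite_UN\<close>)
  also have "\<dots> \<le> emeasure M (\<Union>j\<in>T. D j) + emeasure M {z \<in> space M. 1 < \<phi> (1 + 2 * t) z}"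
    by (rule emeasure_subadditive) (use T Dsets x in \<open>auto simp: \<phi>_def intro!: sets.Un sets.finite_UN\<close>)
  also have "emeasure M (\<Union>j\<in>T. D j) = ennreal m"
    using T Dsets disjT Dfin by (subst sum_emeasure[symmetric]) (auto simp: m_def)
  also have "emeasure M {z \<in> space M. 1 < \<phi> (1 + 2 * t) z} \<le> ennreal ((1 + 2 * t) ^ d * m)"
    unfolding \<phi>_def m_def using t T x r by (intro crowded_set_measure) auto
  finally have "emeasure M (\<Union>i<n. B (x i) (t * r i)) \<le> ennreal m + ennreal ((1 + 2 * t) ^ d * m)"
    by (simp add: add_left_mono)
  also have "\<dots> = ennreal (1 + (1 + 2 * t) ^ d) * ennreal m"
    using t by (simp add: m_def sum_nonneg ennreal_plus[symmetric] ennreal_mult'[symmetric] algebra_simps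
      del: ennreal_plus)
  finally have cover: "emeasure M (\<Union>i<n. B (x i) (t * r i)) \<le> ennreal (1 + (1 + 2 * t) ^ d) * ennreal m" .

  have "a * ennreal m = (\<Sum>j\<in>T. a * ennreal (measure M (D j)))"
    by (simp add: m_def sum_distrib_left flip: sum_ennreal)
  also have "\<dots> \<le> (\<Sum>j\<in>T. ennreal (measure M (D j) / (V * r j ^ d)) * (\<integral>\<^sup>+z\<in>B (x j) (r j). f z \<partial>M))"
  proof (rule sum_mono)
    fix j assume j: "j \<in> T"
    have "V * r j ^ d > 0" using T(2)[OF j] r V_pos by simp
    then have "measure M (D j) = measure M (D j) / (V * r j ^ d) * (V * r j ^ d)"
      by (metis less_irrefl nonzero_eq_divide_eq)
    also have "ennreal \<dots> = ennreal (measure M (D j) / (V * r j ^ d)) * emeasure M (B (x j) (r j))"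
      using w0[OF j] x r T(2)[OF j] by (simp only: emeasure_ball ennreal_mult')
    finally have "ennreal (measure M (D j))
        = ennreal (measure M (D j) / (V * r j ^ d)) * emeasure M (B (x j) (r j))" .
    then have "a * ennreal (measure M (D j))
        = ennreal (measure M (D j) / (V * r j ^ d)) * (a * emeasure M (B (x j) (r j)))"
      by (simp add: ac_simps)
    also have "\<dots> \<le> ennreal (measure M (D j) / (V * r j ^ d)) * (\<integral>\<^sup>+z\<in>B (x j) (r j). f z \<partial>M)"
      using a T j by (intro mult_left_mono) auto
    finally show "a * ennreal (measure M (D j)) \<le> \<dots>" .
  qed
  also have "\<dots> = (\<integral>\<^sup>+z. (\<Sum>j\<in>T. ennreal (measure M (D j) / (V * r j ^ d)) * (f z * indicator (B (x j) (r j)) z)) \<partial>M)"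
    using T x by (subst nn_integral_sum) (auto simp: nn_integral_cmult)
  also have "\<dots> = (\<integral>\<^sup>+z. ennreal (\<phi> 1 z) * f z \<partial>M)"
  proof (rule nn_integral_cong)
    fix z
    define c where "c j = measure M (D j) / (V * r j ^ d)" for j
    have "ennreal (\<phi> 1 z) = ennreal (\<Sum>j\<in>T. c j * indicator (B (x j) (r j)) z)"
      by (simp add: \<phi>_def c_def)
    also have "\<dots> = (\<Sum>j\<in>T. ennreal (c j) * indicator (B (x j) (r j)) z)"
      using w0 unfolding c_def[symmetric]
      by (subst sum_ennreal[symmetric]) (auto simp: ennreal_mult' ennreal_indicator)
    finally have "ennreal (\<phi> 1 z)
        = (\<Sum>j\<in>T. ennreal (measure M (D j) / (V * r j ^ d)) * indicator (B (x j) (r j)) z)"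
      by (simp only: c_def)
    then show "(\<Sum>j\<in>T. ennreal (measure M (D j) / (V * r j ^ d)) * (f z * indicator (B (x j) (r j)) z))
        = ennreal (\<phi> 1 z) * f z"
      by (simp add: sum_distrib_left ac_simps)
  qed
  also have "\<dots> \<le> (\<integral>\<^sup>+z. ennreal L * f z \<partial>M)"
  proof (intro nn_integral_mono mult_right_mono ennreal_leI)
    fix z assume z: "z \<in> space M"
    have "\<phi> 1 z = (\<Sum>j\<in>T. measure M (D j) / (V * r j ^ d) * indicator (B (x j) (r j)) z)"
      by (simp add: \<phi>_def)
    also have "\<dots> \<le> L"
      unfolding L_def
    proof (rule bounded_overlap)
      fix i assume i: "i \<in> T"
      show "(\<Sum>j\<in>T \<inter> {..<i}. measure M (D j) / (V * r j ^ d) *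
               indicator (B (x j) ((1 + t) * r j)) (x i)) \<le> 1"
        using S[of i] T(2,3)[OF i] by (subst TS) auto
    qed (use T t x r decr Dsets Dsub disjT z in auto)
    finally show "\<phi> 1 z \<le> L" .
  qed auto
  also have "\<dots> = ennreal L * (\<integral>\<^sup>+z. f z \<partial>M)" by (simp add: nn_integral_cmult)
  finally have mass: "a * ennreal m \<le> ennreal L * (\<integral>\<^sup>+z. f z \<partial>M)" .

  have "a * emeasure M (\<Union>i<n. B (x i) (t * r i)) \<le> a * (ennreal (1 + (1 + 2 * t) ^ d) * ennreal m)"
    using cover by (rule mult_left_mono) simp
  also have "\<dots> = ennreal (1 + (1 + 2 * t) ^ d) * (a * ennreal m)" by (simp add: ac_simps)
  also have "\<dots> \<le> ennreal (1 + (1 + 2 * t) ^ d) * (ennreal L * (\<integral>\<^sup>+z. f z \<partial>M))"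
    using mass by (rule mult_left_mono) simp
  also have "\<dots> = ennreal (weak_type_bound d t) * (\<integral>\<^sup>+z. f z \<partial>M)"
    using t by (simp add: weak_type_bound_def L_def ennreal_mult' mult.assoc)
  finally show ?thesis .
qed

lemma finite_family_bound:
  fixes f :: "'a \<Rightarrow> ennreal"
  assumes t: "0 < t" "t \<le> 1" and F: "finite F"
    and xr: "\<And>x r. (x, r) \<in> F \<Longrightarrow> x \<in> space M \<and> r > 0"
    and f: "f \<in> borel_measurable M"
    and a: "\<And>x r. (x, r) \<in> F \<Longrightarrow> a * emeasure M (B x r) \<le> (\<integral>\<^sup>+z\<in>B x r. f z \<partial>M)"
  shows "a * emeasure M (\<Union>(x, r)\<in>F. B x (t * r)) \<le> ennreal (weak_type_bound d t) * (\<integral>\<^sup>+z. f z \<partial>M)"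
proof -
  obtain xs where xs: "set xs = F" using F finite_list by blast
  define ys where "ys = sort_key (\<lambda>p. - snd p) xs"
  have ys: "set ys = F" by (simp add: ys_def xs)
  have sorted: "sorted (map (\<lambda>p. - snd p) ys)" by (simp add: ys_def)
  have mem: "(fst (ys ! i), snd (ys ! i)) \<in> F" if "i < length ys" for i
    using that ys by auto
  note nth = xr[OF mem] a[OF mem]
  have "(\<Union>(x, r)\<in>F. B x (t * r)) = (\<Union>i<length ys. B (fst (ys ! i)) (t * snd (ys ! i)))"
    unfolding ys[symmetric] set_conv_nth by (auto simp: split_beta)
  moreover have "a * emeasure M (\<Union>i<length ys. B (fst (ys ! i)) (t * snd (ys ! i)))
      \<le> ennreal (weak_type_bound d t) * (\<integral>\<^sup>+z. f z \<partial>M)"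
  proof (rule sorted_family_bound[OF t _ _ _ f])
    fix i j assume "i \<le> j" "j < length ys"
    then show "snd (ys ! j) \<le> snd (ys ! i)"
      using sorted_nth_mono[OF sorted, of i j] by simp
  qed (use nth in auto)
  ultimately show ?thesis by simp
qed

lemma countable_family_bound:
  fixes f :: "'a \<Rightarrow> ennreal"
  assumes t: "0 < t" "t \<le> 1" and F: "countable F"
    and xr: "\<And>x r. (x, r) \<in> F \<Longrightarrow> x \<in> space M \<and> r > 0"
    and f: "f \<in> borel_measurable M"
    and a: "\<And>x r. (x, r) \<in> F \<Longrightarrow> a * emeasure M (B x r) \<le> (\<integral>\<^sup>+z\<in>B x r. f z \<partial>M)"
  shows "a * emeasure M (\<Union>(x, r)\<in>F. B x (t * r)) \<le> ennreal (weak_type_bound d t) * (\<integral>\<^sup>+z. f z \<partial>M)"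
proof (cases "F = {}")
  case False
  define G where "G n = from_nat_into F ` {..<n}" for n
  define U where "U n = (\<Union>(x, r)\<in>G n. B x (t * r))" for n
  have G: "G n \<subseteq> F" "finite (G n)" for n
    using from_nat_into[OF False] by (auto simp: G_def)
  have "F = (\<Union>n. G n)"
    using range_from_nat_into[OF False F] by (auto simp: G_def)
  then have "emeasure M (\<Union>(x, r)\<in>F. B x (t * r)) = emeasure M (\<Union>n. U n)"
    by (simp add: U_def)
  also have "\<dots> = (SUP n. emeasure M (U n))"
  proof (rule SUP_emeasure_incseq[symmetric])
    have "U n \<in> sets M" for n
      unfolding U_def
    proof (rule sets.finite_UN[OF G(2)])
      fix p assume "p \<in> G n"
      then have "(fst p, snd p) \<in> F" using G(1) by auto
      then have "B (fst p) (t * snd p) \<in> sets M"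
        using ball_sets xr by blast
      then show "(case p of (x, r) \<Rightarrow> B x (t * r)) \<in> sets M"
        by (simp add: split_beta)
    qed
    then show "range U \<subseteq> sets M" by auto
    have "G m \<subseteq> G n" if "m \<le> n" for m n
      unfolding G_def using that by (intro image_mono) auto
    then show "incseq U" unfolding incseq_def U_def by (intro allI impI UN_mono) auto
  qed
  finally have "a * emeasure M (\<Union>(x, r)\<in>F. B x (t * r)) = (SUP n. a * emeasure M (U n))"
    by (simp add: SUP_mult_left_ennreal)
  also have "\<dots> \<le> ennreal (weak_type_bound d t) * (\<integral>\<^sup>+z. f z \<partial>M)"
  proof (rule SUP_least)
    fix n
    show "a * emeasure M (U n) \<le> ennreal (weak_type_bound d t) * (\<integral>\<^sup>+z. f z \<partial>M)"
      unfolding U_def by (rule finite_family_bound[OF t G(2) _ f]) (use G(1) xr a in blast)+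
  qed
  finally show ?thesis .
qed simp

end

section \<open>Lebesgue measure of the balls of a norm\<close>

lemma emeasure_lborel_affine:
  fixes a c :: real
  assumes "c > 0" "A \<in> sets borel"
  shows "ennreal c * emeasure lborel {x. a + c * x \<in> A} = emeasure lborel A"
proof -
  have "emeasure lborel A = emeasure (density (distr lborel borel (\<lambda>x. a + c * x)) (\<lambda>_. ennreal \<bar>c\<bar>)) A"
    using lborel_real_affine[of c a] assms(1) by simp
  also have "\<dots> = ennreal c * emeasure lborel {x. a + c * x \<in> A}"
    using assms by (simp add: emeasure_density_const emeasure_distr vimage_def)
  finally show ?thesis by simp
qed

text \<open>
  A product measure is determined by its values on boxes, where the claim is the one-dimensional one
  in each coordinate.
\<close>

lemma emeasure_PiM_lborel_affine:
  fixes a :: "'i \<Rightarrow> real" and c :: real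
  assumes I: "finite I" and c: "c > 0" and A: "A \<in> sets (\<Pi>\<^sub>M i\<in>I. lborel)"
  shows "ennreal c ^ card I * emeasure (\<Pi>\<^sub>M i\<in>I. lborel) {x \<in> I \<rightarrow>\<^sub>E UNIV. (\<lambda>i\<in>I. a i + c * x i) \<in> A}
           = emeasure (\<Pi>\<^sub>M i\<in>I. lborel) A"
proof -
  let ?P = "\<Pi>\<^sub>M i\<in>I. lborel :: real measure"
  let ?T = "\<lambda>x. \<lambda>i\<in>I. a i + c * x i"
  interpret product_sigma_finite "\<lambda>_::'i. lborel :: real measure"
    by standard
  have T [measurable]: "?T \<in> measurable ?P ?P"
    by (intro measurable_restrict) measurable
  have "scale_measure (ennreal c ^ card I) (distr ?P ?P ?T) = ?P"
  proof (rule PiM_eqI[OF I])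
    fix A :: "'i \<Rightarrow> real set" assume A: "\<And>i. i \<in> I \<Longrightarrow> A i \<in> sets lborel"
    have pre: "?T -` Pi\<^sub>E I A \<inter> space ?P = (\<Pi>\<^sub>E i\<in>I. {x. a i + c * x \<in> A i})"
      by (auto simp: space_PiM PiE_iff)
    have "{x. a i + c * x \<in> A i} \<in> sets borel" if "i \<in> I" for i
      using A[OF that] measurable_sets[of "\<lambda>x. a i + c * x" borel borel "A i"] by (simp add: vimage_def)
    then have "emeasure (distr ?P ?P ?T) (Pi\<^sub>E I A)
        = (\<Prod>i\<in>I. emeasure lborel {x. a i + c * x \<in> A i})"
      using A I by (subst emeasure_distr[OF T]) (auto simp: pre emeasure_PiM intro!: sets_PiM_I_finite)
    then show "emeasure (scale_measure (ennreal c ^ card I) (distr ?P ?P ?T)) (Pi\<^sub>E I A)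
        = (\<Prod>i\<in>I. emeasure lborel (A i))"
      using A c by (simp add: prod_constant[symmetric] prod.distrib[symmetric] emeasure_lborel_affine
        del: prod_constant cong: prod.cong)
  qed simp
  then have "emeasure ?P A = emeasure (scale_measure (ennreal c ^ card I) (distr ?P ?P ?T)) A"
    by simp
  also have "\<dots> = ennreal c ^ card I * emeasure ?P (?T -` A \<inter> space ?P)"
    using A by (simp add: emeasure_distr)
  also have "?T -` A \<inter> space ?P = {x \<in> I \<rightarrow>\<^sub>E UNIV. ?T x \<in> A}"
    by (auto simp: space_PiM)
  finally show ?thesis by simp
qed

context
  fixes d :: nat and N :: "(nat \<Rightarrow> real) \<Rightarrow> real"
  assumes N: "norm_on_Rn d N"
begin

lemma norm_zero: "N (\<lambda>i\<in>{..<d}. 0) = 0"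
  using N unfolding norm_on_Rn_def by auto

lemma restrict_in_Rn: "restrict x {..<d} \<in> Rn d"
  by simp

lemma norm_add: "N (\<lambda>i\<in>{..<d}. x i + y i) \<le> N (restrict x {..<d}) + N (restrict y {..<d})"
proof -
  have "N (\<lambda>i\<in>{..<d}. restrict x {..<d} i + restrict y {..<d} i)
      \<le> N (restrict x {..<d}) + N (restrict y {..<d})"
    using N[unfolded norm_on_Rn_def] restrict_in_Rn[of x] restrict_in_Rn[of y] by blast
  moreover have "(\<lambda>i\<in>{..<d}. restrict x {..<d} i + restrict y {..<d} i) = (\<lambda>i\<in>{..<d}. x i + y i)"
    by auto
  ultimately show ?thesis by simp
qed

lemma norm_scale: "N (\<lambda>i\<in>{..<d}. c * x i) = \<bar>c\<bar> * N (restrict x {..<d})"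
proof -
  have "N (\<lambda>i\<in>{..<d}. c * restrict x {..<d} i) = \<bar>c\<bar> * N (restrict x {..<d})"
    using N[unfolded norm_on_Rn_def] restrict_in_Rn[of x] by blast
  moreover have "(\<lambda>i\<in>{..<d}. c * restrict x {..<d} i) = (\<lambda>i\<in>{..<d}. c * x i)"
    by auto
  ultimately show ?thesis by simp
qed

lemma norm_diff_commute: "N (\<lambda>i\<in>{..<d}. x i - y i) = N (\<lambda>i\<in>{..<d}. y i - x i)"
  using norm_scale[of "-1" "\<lambda>i. y i - x i"] by simp

lemma norm_diff_triangle:
  "N (\<lambda>i\<in>{..<d}. x i - z i) \<le> N (\<lambda>i\<in>{..<d}. x i - y i) + N (\<lambda>i\<in>{..<d}. y i - z i)"
  using norm_add[of "\<lambda>i. x i - y i" "\<lambda>i. y i - z i"] by simp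

text \<open>
  Truncating \<open>x\<close> after \<open>n\<close> coordinates permits an induction in which the dimension is fixed. For
  \<open>n = d\<close> it shows that \<open>N\<close> is Lipschitz in the coordinates, hence continuous.
\<close>

lemma norm_le_coordinates:
  "n \<le> d \<Longrightarrow> N (\<lambda>i\<in>{..<d}. if i < n then x i else 0)
     \<le> (\<Sum>k<n. \<bar>x k\<bar> * N (\<lambda>i\<in>{..<d}. if i = k then 1 else 0))"
proof (induction n)
  case 0
  have "(\<lambda>i\<in>{..<d}. if i < 0 then x i else 0) = (\<lambda>i\<in>{..<d}. 0)" by auto
  then show ?case by (simp only: norm_zero) simp
next
  case (Suc n)
  have "(\<lambda>i\<in>{..<d}. if i < Suc n then x i else 0)
      = (\<lambda>i\<in>{..<d}. (if i < n then x i else 0) + x n * (if i = n then 1 else 0))"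
    by (auto simp: fun_eq_iff less_Suc_eq)
  then have "N (\<lambda>i\<in>{..<d}. if i < Suc n then x i else 0)
      \<le> N (\<lambda>i\<in>{..<d}. if i < n then x i else 0) + N (\<lambda>i\<in>{..<d}. x n * (if i = n then 1 else 0))"
    using norm_add[of "\<lambda>i. if i < n then x i else 0" "\<lambda>i. x n * (if i = n then 1 else 0)"] by (simp only:)
  also have "\<dots> \<le> (\<Sum>k<n. \<bar>x k\<bar> * N (\<lambda>i\<in>{..<d}. if i = k then 1 else 0))
      + \<bar>x n\<bar> * N (\<lambda>i\<in>{..<d}. if i = n then 1 else 0)"
  proof (rule add_mono)
    show "N (\<lambda>i\<in>{..<d}. if i < n then x i else 0)
        \<le> (\<Sum>k<n. \<bar>x k\<bar> * N (\<lambda>i\<in>{..<d}. if i = k then 1 else 0))"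
      using Suc.prems by (intro Suc.IH) simp
  qed (rule eq_refl, rule norm_scale)
  finally show ?case by (simp only: sum.lessThan_Suc)
qed

text \<open>
  Continuity refers to the product topology on all functions \<open>nat \<Rightarrow> real\<close>, composed with the
  restriction to the first \<open>d\<close> coordinates. Thus a ball extends to an open cylinder in a second
  countable space, in which Lindelof's theorem is available.
\<close>

lemma continuous_norm: "continuous_on UNIV (\<lambda>x. N (restrict x {..<d}))"
proof -
  define g where "g x y = (\<Sum>k<d. \<bar>y k - x k\<bar> * N (\<lambda>i\<in>{..<d}. if i = k then 1 else 0))" for x y :: "nat \<Rightarrow> real"
  have g: "N (restrict y {..<d}) - N (restrict x {..<d}) \<le> g x y" for x y
  proof -
    have "(\<lambda>i\<in>{..<d}. if i < d then y i - x i else 0) = (\<lambda>i\<in>{..<d}. y i - x i)"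
      by auto
    then have "N (\<lambda>i\<in>{..<d}. y i - x i) \<le> g x y"
      using norm_le_coordinates[of d "\<lambda>i. y i - x i"] by (simp add: g_def)
    then show ?thesis using norm_add[of "\<lambda>i. y i - x i" x] by simp
  qed
  have sym: "g x y = g y x" for x y by (simp add: g_def abs_minus_commute)
  have "isCont (\<lambda>y. N (restrict y {..<d})) x" for x
  proof -
    have "continuous_on UNIV (g x)"
      unfolding g_def by (intro continuous_intros continuous_on_product_coordinates)
    then have "(g x \<longlongrightarrow> g x x) (at x)"
      by (simp add: continuous_on_eq_continuous_at isCont_def)
    then have "(g x \<longlongrightarrow> 0) (at x)" by (simp add: g_def)
    moreover have "\<forall>\<^sub>F y in at x. norm (N (restrict y {..<d}) - N (restrict x {..<d})) \<le> g x y"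
      using g[of _ x] g[of x] sym by (intro always_eventually) (auto simp: abs_le_iff)
    ultimately have "((\<lambda>y. N (restrict y {..<d}) - N (restrict x {..<d})) \<longlongrightarrow> 0) (at x)"
      by (rule Lim_null_comparison[rotated])
    then show ?thesis unfolding isCont_def by (simp add: LIM_zero_iff)
  qed
  then show ?thesis by (simp add: continuous_on_eq_continuous_at)
qed

lemma continuous_norm_diff: "continuous_on UNIV (\<lambda>y. N (\<lambda>i\<in>{..<d}. x i - y i))"
  by (rule continuous_on_compose2[OF continuous_norm, where f = "\<lambda>y i. x i - y i"])
    (auto intro!: continuous_intros continuous_on_product_coordinates)

lemma norm_ball_sets: "norm_ball d N x r \<in> sets (\<Pi>\<^sub>M i\<in>{..<d}. lborel)"
proof -
  let ?P = "\<Pi>\<^sub>M i\<in>{..<d}. lborel :: real measure"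
  \<comment> \<open>coordinates from \<open>d\<close> on are constant on the space of the product measure\<close>
  have "(\<lambda>y. y) \<in> borel_measurable ?P"
  proof (rule measurable_coordinatewise_then_product)
    fix i
    show "(\<lambda>y. y i) \<in> borel_measurable ?P"
    proof (cases "i < d")
      case False
      then have "y i = undefined" if "y \<in> space ?P" for y
        using that by (auto simp: space_PiM PiE_def extensional_def)
      then show ?thesis by (subst measurable_cong[where g = "\<lambda>_. undefined"]) auto
    qed (auto intro!: measurable_component_singleton)
  qed
  then have [measurable]: "(\<lambda>y. N (\<lambda>i\<in>{..<d}. x i - y i)) \<in> borel_measurable ?P"
    using measurable_compose borel_measurable_continuous_onI[OF continuous_norm_diff] by blast
  have "norm_ball d N x r = {y \<in> space ?P. N (\<lambda>i\<in>{..<d}. x i - y i) < r}"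
    by (simp add: norm_ball_def space_PiM)
  then show ?thesis by simp
qed

lemma emeasure_norm_ball:
  assumes "r > 0"
  shows "emeasure (lebesgue_Rn d) (norm_ball d N x r)
           = ennreal (r ^ d) * emeasure (lebesgue_Rn d) (norm_ball d N (\<lambda>_. 0) 1)"
proof -
  let ?P = "\<Pi>\<^sub>M i\<in>{..<d}. lborel :: real measure"
  have pre: "{y \<in> Rn d. (\<lambda>i\<in>{..<d}. - x i / r + 1 / r * y i) \<in> norm_ball d N (\<lambda>_. 0) 1} = norm_ball d N x r"
  proof -
    have "N (\<lambda>i\<in>{..<d}. 0 - (\<lambda>i\<in>{..<d}. - x i / r + 1 / r * y i) i) = N (\<lambda>i\<in>{..<d}. x i - y i) / r" for y
    proof -
      have "(\<lambda>i\<in>{..<d}. 0 - (\<lambda>i\<in>{..<d}. - x i / r + 1 / r * y i) i) = (\<lambda>i\<in>{..<d}. 1 / r * (x i - y i))"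
        using assms by (auto simp: fun_eq_iff diff_divide_distrib)
      then show ?thesis using norm_scale[of "1 / r" "\<lambda>i. x i - y i"] assms by simp
    qed
    then show ?thesis using assms by (auto simp: norm_ball_def)
  qed
  have "ennreal (1 / r) ^ card {..<d} * emeasure ?P {y \<in> Rn d. (\<lambda>i\<in>{..<d}. - x i / r + 1 / r * y i)
      \<in> norm_ball d N (\<lambda>_. 0) 1} = emeasure ?P (norm_ball d N (\<lambda>_. 0) 1)"
    using assms norm_ball_sets by (intro emeasure_PiM_lborel_affine) auto
  then have "ennreal (1 / r) ^ d * emeasure ?P (norm_ball d N x r) = emeasure ?P (norm_ball d N (\<lambda>_. 0) 1)"
    unfolding pre by simp
  then have "ennreal (r ^ d) * emeasure ?P (norm_ball d N (\<lambda>_. 0) 1)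
      = (ennreal (r ^ d) * ennreal (1 / r) ^ d) * emeasure ?P (norm_ball d N x r)"
    by (simp add: mult.assoc)
  also have "ennreal (r ^ d) * ennreal (1 / r) ^ d = 1"
    using assms by (simp add: ennreal_power ennreal_mult'[symmetric] power_one_over)
  finally show ?thesis using norm_ball_sets by (simp add: lebesgue_Rn_def)
qed

text \<open>
  The balls with integer radii exhaust a space of nonzero measure, and all their measures are
  multiples of the measure of the unit ball.
\<close>

lemma emeasure_unit_ball_pos: "emeasure (lebesgue_Rn d) (norm_ball d N (\<lambda>_. 0) 1) > 0"
proof (rule ccontr)
  let ?L = "lebesgue_Rn d"
  assume "\<not> ?thesis"
  then have "emeasure ?L (norm_ball d N (\<lambda>_. 0) (real (Suc n))) = 0" for n
    by (subst emeasure_norm_ball) auto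
  then have "emeasure ?L (\<Union>n. norm_ball d N (\<lambda>_. 0) (real (Suc n))) = 0"
    using norm_ball_sets by (intro emeasure_UN_eq_0) (auto simp: lebesgue_Rn_def)
  moreover have "(\<Union>n. norm_ball d N (\<lambda>_. 0) (real (Suc n))) = Rn d"
  proof -
    have "\<exists>n. u < real (Suc n)" for u
      by (metis less_SucI of_nat_less_iff order.strict_trans reals_Archimedean2 lessI)
    then show ?thesis by (auto simp: norm_ball_def)
  qed
  moreover have "emeasure ?L (Rn d) = (\<Prod>i<d. \<infinity>)"
  proof -
    interpret product_sigma_finite "\<lambda>_::nat. lborel :: real measure" by standard
    have "Rn d \<in> sets (\<Pi>\<^sub>M i\<in>{..<d}. lborel :: real measure)"
      by (intro sets_PiM_I_finite) auto
    then have "emeasure ?L (Rn d) = (\<Prod>i<d. emeasure lborel (UNIV :: real set))"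
      by (simp add: lebesgue_Rn_def emeasure_PiM)
    then show ?thesis by simp
  qed
  ultimately show False by (auto simp: prod_zero_iff)
qed

section \<open>The weak type inequality\<close>

text \<open>
  Every ball with average above \<open>a\<close> is shrunk by the factor \<open>t\<close>; Lindelof's theorem extracts
  countably many of the shrunk balls that still cover the level set. The case of a
  unit ball of infinite measure is vacuous, by the equivalence of norms on \<open>Rn d\<close>; all averages
  vanish in it.
\<close>

lemma maximal_fun_weak_type:
  assumes d: "d > 0" and t: "0 < t" "t \<le> 1"
    and g: "integrable (lebesgue_Rn d) g" and a: "a > 0"
  shows "emeasure (lebesgue_Rn d) {x \<in> space (lebesgue_Rn d). maximal_fun d N g x > ennreal a}
           \<le> ennreal (weak_type_bound d t) * ennreal (\<integral>x. \<bar>g x\<bar> \<partial>lebesgue_Rn d) / ennreal a"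
proof (cases "emeasure (lebesgue_Rn d) (norm_ball d N (\<lambda>_. 0) 1) = \<infinity>")
  case True
  then have "emeasure (lebesgue_Rn d) (norm_ball d N x r) = \<infinity>" if "r > 0" for x r
    using that by (subst emeasure_norm_ball[OF that]) (simp add: ennreal_mult_top)
  then have "maximal_fun d N g x \<le> 0" for x
    unfolding maximal_fun_def by (intro SUP_least) simp
  then show ?thesis by simp
next
  case False
  let ?L = "lebesgue_Rn d"
  define V where "V = measure ?L (norm_ball d N (\<lambda>_. 0) 1)"
  have V: "emeasure ?L (norm_ball d N (\<lambda>_. 0) 1) = ennreal V"
    using False by (simp add: V_def emeasure_eq_ennreal_measure)
  then have "V > 0" using emeasure_unit_ball_pos by simp
  interpret homogeneous_balls ?L "\<lambda>x y. N (\<lambda>i\<in>{..<d}. x i - y i)" d V "norm_ball d N"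
  proof
    show "norm_ball d N x r = {y \<in> space ?L. N (\<lambda>i\<in>{..<d}. x i - y i) < r}" for x r
      by (simp add: norm_ball_def space_lebesgue_Rn)
    show "N (\<lambda>i\<in>{..<d}. x i - y i) = N (\<lambda>i\<in>{..<d}. y i - x i)" for x y
      by (rule norm_diff_commute)
    show "N (\<lambda>i\<in>{..<d}. x i - z i) \<le> N (\<lambda>i\<in>{..<d}. x i - y i) + N (\<lambda>i\<in>{..<d}. y i - z i)" for x y z
      by (rule norm_diff_triangle)
    show "norm_ball d N x r \<in> sets ?L" for x r
      using norm_ball_sets by (simp add: lebesgue_Rn_def)
    show "emeasure ?L (norm_ball d N x r) = ennreal (V * r ^ d)" if "r > 0" for x r
      using emeasure_norm_ball[OF that] V \<open>V > 0\<close> that by (simp add: ennreal_mult'[symmetric] mult.commute)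
  qed (use \<open>V > 0\<close> d in auto)
  define E where "E = {x \<in> space ?L. maximal_fun d N g x > ennreal a}"
  have "\<exists>r>0. ennreal a * emeasure ?L (norm_ball d N x r)
      \<le> (\<integral>\<^sup>+y\<in>norm_ball d N x r. ennreal \<bar>g y\<bar> \<partial>?L)" if x: "x \<in> E" for x
  proof -
    obtain r where r: "r > 0" "ennreal a < (\<integral>\<^sup>+y\<in>norm_ball d N x r. ennreal \<bar>g y\<bar> \<partial>?L)
        / emeasure ?L (norm_ball d N x r)"
      using x unfolding E_def maximal_fun_def by (auto simp: less_SUP_iff)
    have "emeasure ?L (norm_ball d N x r) = ennreal (V * r ^ d)" "V * r ^ d > 0"
      using r(1) x \<open>V > 0\<close> by (auto simp: E_def intro!: emeasure_ball)
    then have "emeasure ?L (norm_ball d N x r) \<noteq> 0" "emeasure ?L (norm_ball d N x r) < top"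
      by (simp_all only: ennreal_eq_0_iff not_le ennreal_less_top)
    then have "\<not> (\<integral>\<^sup>+y\<in>norm_ball d N x r. ennreal \<bar>g y\<bar> \<partial>?L)
        < ennreal a * emeasure ?L (norm_ball d N x r)"
      using r(2) divide_less_ennreal by (metis less_asym)
    then show ?thesis using r(1) by (auto simp: not_less)
  qed
  then obtain r where r: "\<And>x. x \<in> E \<Longrightarrow> r x > 0 \<and> ennreal a * emeasure ?L (norm_ball d N x (r x))
      \<le> (\<integral>\<^sup>+y\<in>norm_ball d N x (r x). ennreal \<bar>g y\<bar> \<partial>?L)"
    by metis
  define U where "U x = {y. N (\<lambda>i\<in>{..<d}. x i - y i) < t * r x}" for x
  have "open (U x)" for x
    unfolding U_def by (rule open_Collect_less[OF continuous_norm_diff continuous_on_const])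
  then obtain E' where E': "E' \<subseteq> E" "countable E'" "(\<Union>x\<in>E'. U x) = (\<Union>x\<in>E. U x)"
    using Lindelof[of "U ` E"] by (metis (no_types, lifting) countable_subset_image imageE)
  have cover: "E \<subseteq> (\<Union>x\<in>E'. norm_ball d N x (t * r x))"
  proof
    fix x assume x: "x \<in> E"
    then have "x \<in> U x" using r t norm_zero by (simp add: U_def)
    then obtain y where "y \<in> E'" "x \<in> U y" using E'(3) x by blast
    then show "x \<in> (\<Union>x\<in>E'. norm_ball d N x (t * r x))"
      using x by (auto simp: U_def norm_ball_def E_def space_lebesgue_Rn)
  qed
  have "ennreal a * emeasure ?L E \<le> ennreal a * emeasure ?L (\<Union>x\<in>E'. norm_ball d N x (t * r x))"
    using cover E' by (intro mult_left_mono emeasure_mono sets.countable_UN')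
      (auto simp: E_def intro!: ball_sets)
  also have "(\<Union>x\<in>E'. norm_ball d N x (t * r x))
      = (\<Union>(x, r)\<in>(\<lambda>x. (x, r x)) ` E'. norm_ball d N x (t * r))"
    by simp
  also have "ennreal a * emeasure ?L \<dots> \<le> ennreal (weak_type_bound d t) * (\<integral>\<^sup>+z. ennreal \<bar>g z\<bar> \<partial>?L)"
    using E' r g by (intro countable_family_bound t) (auto simp: E_def)
  also have "(\<integral>\<^sup>+z. ennreal \<bar>g z\<bar> \<partial>?L) = ennreal (\<integral>x. \<bar>g x\<bar> \<partial>?L)"
    using g by (intro nn_integral_eq_integral) auto
  finally have "ennreal a * emeasure ?L E / ennreal a
      \<le> ennreal (weak_type_bound d t) * ennreal (\<integral>x. \<bar>g x\<bar> \<partial>?L) / ennreal a"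
    by (rule divide_right_mono_ennreal)
  then show ?thesis
    using a unfolding E_def by (simp add: mult.commute[of "ennreal a"] ennreal_mult_divide_eq)
qed

end

theorem theorem5p2:
  fixes \<epsilon> :: real
  assumes "\<epsilon> > 0"
  shows "\<exists>d0::nat. \<forall>d\<ge>d0. \<forall>N. norm_on_Rn d N \<longrightarrow>
           weak_L1_opnorm (lebesgue_Rn d) (maximal_fun d N)
             \<le> ennreal ((2 + 3 * \<epsilon>) * real d * ln (real d))"
proof -
  let ?t = "\<lambda>d. 1 / (real d * ln (real d))"
  have "\<forall>\<^sub>F d in sequentially. weak_type_bound d (?t d) / (real d * ln (real d)) < 2 + 3 * \<epsilon>"
    using weak_type_bound_asymp assms by (intro order_tendstoD) auto
  moreover have "\<forall>\<^sub>F d in sequentially. 1 \<le> real d * ln (real d)"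
    by real_asymp
  ultimately have "\<forall>\<^sub>F d in sequentially. d > 0 \<and> 0 < ?t d \<and> ?t d \<le> 1 \<and>
      weak_type_bound d (?t d) \<le> (2 + 3 * \<epsilon>) * real d * ln (real d)"
    using eventually_gt_at_top[of 0]
    by eventually_elim (auto simp: field_simps)
  then obtain d0 where d0: "\<And>d. d \<ge> d0 \<Longrightarrow> d > 0 \<and> 0 < ?t d \<and> ?t d \<le> 1 \<and>
      weak_type_bound d (?t d) \<le> (2 + 3 * \<epsilon>) * real d * ln (real d)"
    by (auto simp: eventually_sequentially)
  have "weak_L1_opnorm (lebesgue_Rn d) (maximal_fun d N)
      \<le> ennreal ((2 + 3 * \<epsilon>) * real d * ln (real d))" if "d \<ge> d0" "norm_on_Rn d N" for d N
  proof -
    have "weak_L1_opnorm (lebesgue_Rn d) (maximal_fun d N) \<le> ennreal (weak_type_bound d (?t d))"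
      unfolding weak_L1_opnorm_def
      using d0[OF that(1)] maximal_fun_weak_type[OF that(2)] by (intro Inf_lower) auto
    also have "\<dots> \<le> ennreal ((2 + 3 * \<epsilon>) * real d * ln (real d))"
      using d0[OF that(1)] by (intro ennreal_leI) auto
    finally show ?thesis .
  qed
  then show ?thesis by blast
qed

end
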